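(* Let $G$ be a connected $(v,k,\lambda,\mu)$-SRG with $v \leq 2k-\lambda+2$. Then $G$ is OK.
   Context: All graphs are finite and simple. A graph $G$ is a strongly regular graph with parameters $v,k,\lambda,\mu$, written $(v,k,\lambda,\mu)$-SRG, if it has $v$ vertices, is $k$-regular, any two adjacent vertices have exactly $\lambda$ common neighbors, and any two distinct non-adjacent vertices have exactly $\mu$ common neighbors. A disconnecting set of a connected graph $G$ is a set $S$ of vertices such that $G\setminus S$ (obtained by deleting the vertices of $S$ and all incident edges) is disconnected. If $G$ has a disconnecting set $S$ such that every component of $G\setminus S$ has at least two vertices, then $\kappa_2(G)$ denotes the minimum size of such a set. A connected $(v,k,\lambda,\mu)$-SRG $G$ is called OK if either it has no disconnecting set $S$ such that each component of $G\setminus S$ has at least two vertices, or $\kappa_2(G)=2k-\lambda-2$. *)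

theory Defs
  imports "Graph_Theory.Digraph_Component"
begin

text \<open>
  Finite simple graphs are the symmetric digraphs of the locale \<^locale>\<open>graph\<close>: finite, without
  loops or parallel arcs, each edge \<open>xy\<close> being represented by the arcs \<open>(x, y)\<close> and \<open>(y, x)\<close>. Hence
  the degree of a vertex is its \<^const>\<open>out_degree\<close>, and the connected components are the elements of
  \<^const>\<open>pre_digraph.sccs\<close>, strong connectivity being the same as connectivity.
\<close>

definition common_neighbors :: "('a, 'b) pre_digraph \<Rightarrow> 'a \<Rightarrow> 'a \<Rightarrow> 'a set" where
  "common_neighbors G x y = {z \<in> verts G. x \<rightarrow>\<^bsub>G\<^esub> z \<and> y \<rightarrow>\<^bsub>G\<^esub> z}"

definition srg :: "('a, 'b) pre_digraph \<Rightarrow> nat \<Rightarrow> nat \<Rightarrow> nat \<Rightarrow> nat \<Rightarrow> bool" where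
  "srg G v k lam mu \<longleftrightarrow>
     graph G \<and>
     card (verts G) = v \<and>
     (\<forall>x \<in> verts G. out_degree G x = k) \<and>
     (\<forall>x \<in> verts G. \<forall>y \<in> verts G. x \<rightarrow>\<^bsub>G\<^esub> y \<longrightarrow> card (common_neighbors G x y) = lam) \<and>
     (\<forall>x \<in> verts G. \<forall>y \<in> verts G. x \<noteq> y \<and> \<not> x \<rightarrow>\<^bsub>G\<^esub> y \<longrightarrow> card (common_neighbors G x y) = mu)"

definition delete_verts :: "('a, 'b) pre_digraph \<Rightarrow> 'a set \<Rightarrow> ('a, 'b) pre_digraph" where
  "delete_verts G S = G \<restriction> (verts G - S)"

text \<open>
  The graph without vertices does not satisfy \<^const>\<open>connected\<close>, but it does not count as
  disconnected either: \<^term>\<open>verts G\<close> itself is not a disconnecting set.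
\<close>

definition disconnecting_set :: "('a, 'b) pre_digraph \<Rightarrow> 'a set \<Rightarrow> bool" where
  "disconnecting_set G S \<longleftrightarrow>
     S \<subseteq> verts G \<and> verts (delete_verts G S) \<noteq> {} \<and> \<not> connected (delete_verts G S)"

definition disconnecting_set2 :: "('a, 'b) pre_digraph \<Rightarrow> 'a set \<Rightarrow> bool" where
  "disconnecting_set2 G S \<longleftrightarrow>
     disconnecting_set G S \<and>
     (\<forall>C \<in> pre_digraph.sccs (delete_verts G S). 2 \<le> card (verts C))"

text \<open>Meaningful only if \<^term>\<open>disconnecting_set2 G S\<close> holds for some \<^term>\<open>S\<close>.\<close>

definition kappa2 :: "('a, 'b) pre_digraph \<Rightarrow> nat" where
  "kappa2 G = Min {card S |S. disconnecting_set2 G S}"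

text \<open>
  The parameters are arguments because \<open>k\<close> and \<open>lam\<close> occur in the definition and \<open>lam\<close> is not
  determined by a graph without edges. The equation is stated over the integers, where subtraction
  does not truncate.
\<close>

definition srg_OK :: "('a, 'b) pre_digraph \<Rightarrow> nat \<Rightarrow> nat \<Rightarrow> nat \<Rightarrow> nat \<Rightarrow> bool" where
  "srg_OK G v k lam mu \<longleftrightarrow>
     srg G v k lam mu \<and> connected G \<and>
     ((\<nexists>S. disconnecting_set2 G S) \<or> int (kappa2 G) = 2 * int k - int lam - 2)"

end

theory Submission
  imports Defs
begin

text \<open>
  Suppose that \<open>S\<close> is a disconnecting set all of whose components have at least two vertices, and
  let \<open>xy\<close> and \<open>zw\<close> be edges in different components. The union of the neighborhoods of \<open>x\<close> and
  \<open>y\<close> has \<open>2k - \<lambda> \<ge> v - 2\<close> elements and misses every component except that of \<open>x\<close>. Hence all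
  vertices outside \<open>S\<close> and outside this component are \<open>z\<close> and \<open>w\<close>; by symmetry the component of
  \<open>x\<close> is \<open>{x, y}\<close>. So \<open>v = 2k - \<lambda> + 2\<close> and \<open>S\<close> has \<open>v - 4 = 2k - \<lambda> - 2\<close> elements.
\<close>

lemma (in wf_digraph) strongly_connected_imp_connected:
  assumes "strongly_connected G"
  shows "connected G"
  using assms unfolding connected_def strongly_connected_def
  by (simp add: reachable_mk_symmetricI)

lemma arcs_ends_induce_subgraph:
  "u \<rightarrow>\<^bsub>G \<restriction> A\<^esub> w \<longleftrightarrow> u \<rightarrow>\<^bsub>G\<^esub> w \<and> u \<in> A \<and> w \<in> A"
  by (auto simp: arcs_ends_conv)

text \<open>The vertices reachable from \<open>u\<close> induce its component. A second vertex there
  is the end of a nontrivial path from \<open>u\<close>, whose first arc is the one wanted.\<close>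

lemma (in sym_digraph) component_has_arc:
  assumes "u \<in> verts G" and "\<forall>C \<in> sccs. 2 \<le> card (verts C)"
  obtains w where "u \<rightarrow>\<^bsub>G\<^esub> w"
proof -
  define A where "A = {w. u \<rightarrow>\<^sup>* w}"
  have "G \<restriction> A \<in> sccs"
    unfolding A_def using assms(1) by (rule induce_reachable_is_in_sccs)
  then have "2 \<le> card A"
    using assms(2) by (metis induce_subgraph_verts)
  then have "\<not> A \<subseteq> {u}"
    using card_mono[of "{u}" A] by auto
  then obtain w where "w \<in> A" "w \<noteq> u"
    by blast
  then have "u \<rightarrow>\<^sup>* w"
    by (simp add: A_def)
  then show thesis
    using \<open>w \<noteq> u\<close> by (metis converse_reachable_cases that)
qed

text \<open>\<open>out_degree\<close> counts arcs; as there are no parallel arcs,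
  \<open>head G\<close> is injective on those leaving \<open>u\<close>.\<close>

lemma (in graph) card_out_neighbors:
  "card {z \<in> verts G. u \<rightarrow>\<^bsub>G\<^esub> z} = out_degree G u"
proof -
  have "inj_on (head G) (out_arcs G u)"
    by (auto intro!: inj_onI no_multi_arcs simp: arc_to_ends_def)
  moreover have "head G ` out_arcs G u = {z \<in> verts G. u \<rightarrow>\<^bsub>G\<^esub> z}"
    by (auto simp: arcs_ends_conv)
  ultimately show ?thesis
    unfolding out_degree_def by (metis card_image)
qed

text \<open>Inclusion-exclusion for two neighborhoods of size \<open>k\<close> meeting in
  \<open>lam\<close> vertices; the additive form avoids truncated subtraction.\<close>

lemma (in graph) card_edge_neighborhood:
  assumes "srg G v k lam mu" and "x \<rightarrow>\<^bsub>G\<^esub> y"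
  shows "card {z \<in> verts G. x \<rightarrow>\<^bsub>G\<^esub> z \<or> y \<rightarrow>\<^bsub>G\<^esub> z} + lam = 2 * k"
proof -
  let ?N = "\<lambda>u. {z \<in> verts G. u \<rightarrow>\<^bsub>G\<^esub> z}"
  have verts: "x \<in> verts G" "y \<in> verts G"
    using assms(2) by (auto dest: adj_in_verts)
  then have deg: "card (?N x) = k" "card (?N y) = k"
    using assms(1) by (simp_all add: card_out_neighbors srg_def)
  have "?N x \<inter> ?N y = common_neighbors G x y"
    by (auto simp: common_neighbors_def)
  then have "card (?N x \<inter> ?N y) = lam"
    using assms verts by (simp add: srg_def)
  moreover have "?N x \<union> ?N y = {z \<in> verts G. x \<rightarrow>\<^bsub>G\<^esub> z \<or> y \<rightarrow>\<^bsub>G\<^esub> z}"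
    by auto
  ultimately show ?thesis
    using card_Un_Int[of "?N x" "?N y"] deg by simp
qed

text \<open>Minimality of \<open>S\<close> is not assumed, so all such sets have the same
  size.\<close>

lemma card_disconnecting_set2:
  assumes srg: "srg G v k lam mu"
    and v: "int v \<le> 2 * int k - int lam + 2"
    and S: "disconnecting_set2 G S"
  shows "int (card S) = 2 * int k - int lam - 2"
proof -
  interpret G: graph G
    using srg by (simp add: srg_def)
  define H where "H = delete_verts G S"
  have vH: "verts H = verts G - S"
    by (simp add: H_def delete_verts_def)
  have S_sub: "S \<subseteq> verts G" and ne: "verts H \<noteq> {}" and nc: "\<not> connected H"
    and sccs: "\<forall>C \<in> pre_digraph.sccs H. 2 \<le> card (verts C)"
    using S by (auto simp: disconnecting_set2_def disconnecting_set_def H_def)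
  have ind: "induced_subgraph H G"
    unfolding H_def delete_verts_def by (intro G.induced_induce) auto
  interpret H: sym_digraph H
    using G.induced_graph_imp_graph[OF ind] .
  have adj: "u \<rightarrow>\<^bsub>H\<^esub> w \<longleftrightarrow> u \<rightarrow>\<^bsub>G\<^esub> w \<and> u \<in> verts H \<and> w \<in> verts H" for u w
    by (simp add: H_def delete_verts_def arcs_ends_induce_subgraph)
  obtain x z where x: "x \<in> verts H" and z: "z \<in> verts H" and xz: "\<not> x \<rightarrow>\<^sup>*\<^bsub>H\<^esub> z"
    using nc ne H.strongly_connected_imp_connected by (auto simp: strongly_connected_def)
  obtain y where xy: "x \<rightarrow>\<^bsub>H\<^esub> y"
    using x sccs by (rule H.component_has_arc)
  obtain w where zw: "z \<rightarrow>\<^bsub>H\<^esub> w"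
    using z sccs by (rule H.component_has_arc)
  \<comment> \<open>\<open>C\<close> is the component of \<open>x\<close>, while \<open>D\<close>
    collects all other components; the counting only uses that no arc joins \<open>C\<close> to
    \<open>D\<close>.\<close>
  define C where "C = {u \<in> verts H. x \<rightarrow>\<^sup>*\<^bsub>H\<^esub> u}"
  define D where "D = verts H - C"
  let ?N = "\<lambda>a b. {u \<in> verts G. a \<rightarrow>\<^bsub>G\<^esub> u \<or> b \<rightarrow>\<^bsub>G\<^esub> u}"
  have C: "x \<in> C" "y \<in> C"
    using x xy by (auto simp: C_def dest: H.adj_in_verts)
  \<comment> \<open>Otherwise the reverse arc from \<open>w\<close> to \<open>z\<close> would make
    \<open>z\<close> reachable from \<open>x\<close>.\<close>
  have "\<not> x \<rightarrow>\<^sup>*\<^bsub>H\<^esub> w"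
    using xz zw by (meson H.reachable_adj_trans H.sym_arcs arcs_ends_symmetric)
  then have D: "z \<in> D" "w \<in> D"
    using z zw xz by (auto simp: C_def D_def dest: H.adj_in_verts)
  have no_arc: "\<not> a \<rightarrow>\<^bsub>G\<^esub> b" "\<not> b \<rightarrow>\<^bsub>G\<^esub> a" if "a \<in> C" "b \<in> D" for a b
  proof -
    show "\<not> a \<rightarrow>\<^bsub>G\<^esub> b"
      using that by (auto simp: C_def D_def adj dest: H.reachable_adj_trans)
    then show "\<not> b \<rightarrow>\<^bsub>G\<^esub> a"
      using G.sym_arcs arcs_ends_symmetric by metis
  qed
  have CD: "C \<inter> D = {}" "C \<union> D = verts G - S"
    by (auto simp: C_def D_def vH)
  have fin: "finite C" "finite D" "finite S"
    using CD(2) finite_subset[OF S_sub] by (metis finite_Un finite_Diff G.finite_verts)+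
  have cardG: "card (verts G) = v"
    using srg by (simp add: srg_def)
  have disjoint_bound: "card (?N a b) + card E \<le> v"
    if "?N a b \<inter> E = {}" "E \<subseteq> verts G" for a b E
  proof -
    have "card (?N a b) + card E = card (?N a b \<union> E)"
      using that finite_subset[OF that(2)] by (simp add: card_Un_disjoint)
    also have "\<dots> \<le> card (verts G)"
      using that(2) by (intro card_mono) auto
    finally show ?thesis
      using cardG by simp
  qed
  have "?N x y \<inter> D = {}" "?N z w \<inter> C = {}"
    using no_arc C D by blast+
  then have ND: "card (?N x y) + card D \<le> v" and NC: "card (?N z w) + card C \<le> v"
    using CD by (blast intro: disjoint_bound)+
  have "x \<noteq> y" "z \<noteq> w"
    using xy zw by (auto simp: adj dest: G.adj_not_same)
  then have "2 \<le> card C" "2 \<le> card D"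
    using C D fin card_mono[of C "{x, y}"] card_mono[of D "{z, w}"] by auto
  moreover have "card (?N x y) + lam = 2 * k" "card (?N z w) + lam = 2 * k"
    using xy zw by (auto intro!: G.card_edge_neighborhood[OF srg] simp: adj)
  moreover have "card C + card D = card (verts G - S)"
    using CD fin by (metis card_Un_disjoint)
  then have "v = card S + card C + card D"
    using cardG S_sub fin(3) card_mono[OF G.finite_verts S_sub] by (simp add: card_Diff_subset)
  \<comment> \<open>\<open>card C\<close> and \<open>card D\<close> lie between 2 and
    \<open>v - (2k - lam) \<le> 2\<close>, so equality holds throughout.\<close>
  ultimately show ?thesis
    using ND NC v by linarith
qed

theorem lemma2p1:
  fixes G :: "('a, 'b) pre_digraph" and v k lam mu :: nat
  assumes "srg G v k lam mu"
    and "connected G"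
    and "int v \<le> 2 * int k - int lam + 2"
  shows "srg_OK G v k lam mu"
proof (cases "\<exists>S. disconnecting_set2 G S")
  case True
  then obtain S where S: "disconnecting_set2 G S" ..
  note card = card_disconnecting_set2[OF assms(1,3)]
  have "card T = card S" if "disconnecting_set2 G T" for T
    using card[OF that] card[OF S] by simp
  \<comment> \<open>The minimum defining \<open>kappa2\<close> is taken over a singleton.\<close>
  then have "{card T |T. disconnecting_set2 G T} = {card S}"
    using S by blast
  then have "kappa2 G = card S"
    by (simp add: kappa2_def)
  then show ?thesis
    using assms(1,2) card[OF S] by (simp add: srg_OK_def)
next
  case False
  then show ?thesis
    using assms(1,2) by (simp add: srg_OK_def)
qed

end
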